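(* Let $k$ be a positive integer that is not a power of $2$, and suppose $A$ is an array corresponding to a solution of $\sum_{i=1}^n 1/x_i=1$, $x_1\leq\dotsb\leq x_n$ (for some positive integer $n$), with each $x_i\in S(k)$. Let $T$ be the array with $c_{0,0}=1$ and all other entries $0$. (a) There is a unique sequence of priority reductions that reduces $A$ to $T$. (b) There is a unique sequence of priority expansions that expands $T$ to $A$.
   Context: For a positive integer $k$ that is not a power of $2$ (so $k\geq3$), let $S(k)=\{2^ak^b\mid a\in\{0,1,2\},\ b\in\mathbb{Z}_{\geq0}\}$; each element is uniquely of the form $2^ak^b$. An array is a finitely supported family of nonnegative integers $c_{a,b}$, $a\in\{0,1,2\}$ (column index), $b\in\mathbb{Z}_{\geq0}$ (row index); row $b$ is $(c_{0,b},c_{1,b},c_{2,b})$. The array corresponding to a solution of $\sum_{i=1}^n 1/x_i=1$, $x_1\leq\dotsb\leq x_n$, with every $x_i\in S(k)$, has $c_{a,b}=$ the number of indices $i$ with $x_i=2^ak^b$. Moves. Each move can be applied forward (a reduction) or in reverse (an expansion), provided that all entries remain nonnegative. Move 1 (forward): for some row $b$ and some $a\in\{0,1\}$ with $c_{a+1,b}\geq2$, decrease $c_{a+1,b}$ by $2$ and increase $c_{a,b}$ by $1$. Moves 2--5 (forward) are given by a rule $u\to v$ with $u,v\in\mathbb{Z}_{\geq0}^3$: for some $b\geq0$ such that row $b+1$ is entrywise $\geq u$, subtract $u$ from row $b+1$ and add $v$ to row $b$. The rules are: Move 2: $(k/4,0,0)\to(0,0,1)$ if $k\equiv0\pmod4$;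 $(k,0,0)\to(1,0,0)$ if $k$ is odd; $(k/2,0,0)\to(0,1,0)$ if $k\equiv2\pmod4$. Move 3 (only for odd $k$): $((k-1)/4,0,1)\to(0,0,1)$ if $k\equiv1\pmod4$; $((3k-1)/4,0,1)\to(0,1,1)$ if $k\equiv3\pmod4$. Move 4 (only for $k\not\equiv0\pmod4$): $((k-1)/2,1,0)\to(0,1,0)$ if $k$ is odd; $((k-2)/4,1,0)\to(0,0,1)$ if $k\equiv2\pmod4$. Move 5 (only for odd $k$): $((3k-3)/4,1,1)\to(0,1,1)$ if $k\equiv1\pmod4$; $((k-3)/4,1,1)\to(0,0,1)$ if $k\equiv3\pmod4$. Priority reductions and expansions. Let $A$ be an array corresponding to a solution with every $x_i\in S(k)$ and let $\beta$ be the index of its top nonzero row (the largest $b$ such that row $b$ is nonzero). The priority reduction of $A$ is the first of the following that can be applied: (1) if $c_{2,\beta}\geq2$, Move 1 reducing the entry $c_{2,\beta}$; (2) if $c_{1,\beta}\geq2$, Move 1 reducing the entry $c_{1,\beta}$; (3), (4), (5), (6): respectively Move 2, Move 3, Move 4, Move 5 (where defined) in the forward direction, with row $\beta$ as the upper row $b+1$. An expansion taking an array $B$ to an array $A$ is a priority expansion if its inverse is the priority reduction of $A$. Sequences of reductions or expansions are finite and may be empty. *)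

theory Defs
  imports Complex_Main "HOL-Library.Product_Plus" "HOL-Library.Product_Order"
begin

definition S :: "nat \<Rightarrow> nat set" where
  "S k = {2 ^ a * k ^ b | a b. a \<in> {0, 1, 2}}"

text \<open>
  Row \<open>b\<close> of an array is the triple of its entries in the columns 0, 1, 2. The operations
  \<open>+\<close>, \<open>-\<close>, \<open>\<le>\<close> and \<open>0\<close> on rows are the componentwise ones; subtraction is only used
  where it does not truncate. Finite support is not part of the type; the arrays that correspond
  to solutions have it whenever \<open>k > 1\<close>.
\<close>

type_synonym row = "nat \<times> nat \<times> nat"
type_synonym array = "nat \<Rightarrow> row"

definition is_solution :: "nat \<Rightarrow> nat list \<Rightarrow> bool" where
  "is_solution k xs \<longleftrightarrow>
     xs \<noteq> [] \<and> sorted xs \<and> set xs \<subseteq> S k \<and> (\<Sum>x\<leftarrow>xs. 1 / real x) = 1"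

definition array_of :: "nat \<Rightarrow> nat list \<Rightarrow> array" where
  "array_of k xs = (\<lambda>b.
     (count_list xs (2 ^ 0 * k ^ b), count_list xs (2 ^ 1 * k ^ b), count_list xs (2 ^ 2 * k ^ b)))"

definition solution_array :: "nat \<Rightarrow> array \<Rightarrow> bool" where
  "solution_array k A \<longleftrightarrow> (\<exists>xs. is_solution k xs \<and> A = array_of k xs)"

definition T :: array where
  "T = (\<lambda>b. 0)(0 := (1, 0, 0))"

text \<open>
  A rule \<open>Some (u, v)\<close> stands for \<open>u \<rightarrow> v\<close>, and \<open>None\<close> for a move that is not defined for the
  given \<open>k\<close>. All divisions below are exact.
\<close>

definition rule2 :: "nat \<Rightarrow> (row \<times> row) option" where
  "rule2 k =
    (if k mod 4 = 0 then Some ((k div 4, 0, 0), (0, 0, 1))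
     else if odd k then Some ((k, 0, 0), (1, 0, 0))
     else Some ((k div 2, 0, 0), (0, 1, 0)))"

definition rule3 :: "nat \<Rightarrow> (row \<times> row) option" where
  "rule3 k =
    (if k mod 4 = 1 then Some (((k - 1) div 4, 0, 1), (0, 0, 1))
     else if k mod 4 = 3 then Some (((3 * k - 1) div 4, 0, 1), (0, 1, 1))
     else None)"

definition rule4 :: "nat \<Rightarrow> (row \<times> row) option" where
  "rule4 k =
    (if odd k then Some (((k - 1) div 2, 1, 0), (0, 1, 0))
     else if k mod 4 = 2 then Some (((k - 2) div 4, 1, 0), (0, 0, 1))
     else None)"

definition rule5 :: "nat \<Rightarrow> (row \<times> row) option" where
  "rule5 k =
    (if k mod 4 = 1 then Some (((3 * k - 3) div 4, 1, 1), (0, 1, 1))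
     else if k mod 4 = 3 then Some (((k - 3) div 4, 1, 1), (0, 0, 1))
     else None)"

text \<open>
  \<open>Move1 a b\<close> acts on row \<open>b\<close>, decreasing the entry in column \<open>a + 1\<close> and increasing the one in
  column \<open>a\<close> (so only \<open>a = 0\<close> and \<open>a = 1\<close> are meaningful). In the other moves, \<open>b\<close> is the lower
  of the two rows \<open>b\<close> and \<open>b + 1\<close> involved.
\<close>

datatype move = Move1 nat nat | Move2 nat | Move3 nat | Move4 nat | Move5 nat

definition reduce_in_row :: "row \<Rightarrow> row \<Rightarrow> nat \<Rightarrow> array \<Rightarrow> array option" where
  "reduce_in_row u v b A = (if u \<le> A b then Some (A(b := A b - u + v)) else None)"

definition reduce_rows :: "(row \<times> row) option \<Rightarrow> nat \<Rightarrow> array \<Rightarrow> array option" where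
  "reduce_rows r b A =
    (case r of
       None \<Rightarrow> None
     | Some (u, v) \<Rightarrow>
         if u \<le> A (b + 1) then Some (A(b + 1 := A (b + 1) - u, b := A b + v)) else None)"

text \<open>
  The result of applying a move in the forward direction; \<open>None\<close> if it cannot be applied.
\<close>

fun reduce :: "nat \<Rightarrow> move \<Rightarrow> array \<Rightarrow> array option" where
  "reduce k (Move1 a b) A =
    (if a = 0 then reduce_in_row (0, 2, 0) (1, 0, 0) b A
     else if a = 1 then reduce_in_row (0, 0, 2) (0, 1, 0) b A
     else None)"
| "reduce k (Move2 b) A = reduce_rows (rule2 k) b A"
| "reduce k (Move3 b) A = reduce_rows (rule3 k) b A"
| "reduce k (Move4 b) A = reduce_rows (rule4 k) b A"
| "reduce k (Move5 b) A = reduce_rows (rule5 k) b A"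

definition reduction :: "nat \<Rightarrow> move \<Rightarrow> array \<Rightarrow> array \<Rightarrow> bool" where
  "reduction k m A B \<longleftrightarrow> reduce k m A = Some B"

text \<open>
  Applying a move in reverse to \<open>B\<close>. That all entries remain nonnegative is expressed by the result
  \<open>A\<close> being an array, and \<open>A\<close> is determined by \<open>m\<close> and \<open>B\<close>.
\<close>

definition expansion :: "nat \<Rightarrow> move \<Rightarrow> array \<Rightarrow> array \<Rightarrow> bool" where
  "expansion k m B A \<longleftrightarrow> reduction k m A B"

definition top_row :: "array \<Rightarrow> nat" where
  "top_row A = Max {b. A b \<noteq> 0}"

text \<open>
  Moves with the top row as the upper of two rows exist only if the top row is not row 0.
\<close>

definition priority_list :: "nat \<Rightarrow> move list" where
  "priority_list \<beta> =
     [Move1 1 \<beta>, Move1 0 \<beta>] @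
     (case \<beta> of 0 \<Rightarrow> [] | Suc b \<Rightarrow> [Move2 b, Move3 b, Move4 b, Move5 b])"

definition priority_move :: "nat \<Rightarrow> array \<Rightarrow> move option" where
  "priority_move k A = find (\<lambda>m. \<exists>B. reduction k m A B) (priority_list (top_row A))"

definition priority_reduction :: "nat \<Rightarrow> move \<Rightarrow> array \<Rightarrow> array \<Rightarrow> bool" where
  "priority_reduction k m A B \<longleftrightarrow>
     solution_array k A \<and> priority_move k A = Some m \<and> reduction k m A B"

definition priority_expansion :: "nat \<Rightarrow> move \<Rightarrow> array \<Rightarrow> array \<Rightarrow> bool" where
  "priority_expansion k m B A \<longleftrightarrow> expansion k m B A \<and> priority_reduction k m A B"

text \<open>
  \<open>move_sequence R A ms B\<close>: performing the moves \<open>ms\<close> one after the other, each as a step of the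
  kind \<open>R\<close>, leads from \<open>A\<close> to \<open>B\<close>. For reductions as well as for expansions the intermediate arrays
  are determined by the starting array and the list of moves, so a sequence of reductions or
  expansions is identified with its list of moves.
\<close>

fun move_sequence ::
  "(move \<Rightarrow> array \<Rightarrow> array \<Rightarrow> bool) \<Rightarrow> array \<Rightarrow> move list \<Rightarrow> array \<Rightarrow> bool" where
  "move_sequence R A [] B \<longleftrightarrow> A = B"
| "move_sequence R A (m # ms) B \<longleftrightarrow> (\<exists>C. R m A C \<and> move_sequence R C ms B)"

end

theory Submission imports Defs "HOL-Library.Multiset" "HOL-Computational_Algebra.Primes" begin

text \<open>
  Multiplying the equation by \<open>4 k ^ \<beta>\<close>, where \<open>\<beta>\<close> is the top nonzero row, shows that
  \<open>4 c\<^sub>0 + 2 c\<^sub>1 + c\<^sub>2\<close> for that row is divisible by \<open>k\<close> if \<open>\<beta> > 0\<close>, and equals \<open>4\<close> if \<open>\<beta> = 0\<close>. If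
  Move 1 does not apply, then \<open>c\<^sub>1, c\<^sub>2 \<le> 1\<close>; writing the multiple of \<open>k\<close> as \<open>k j\<close>, the congruence
  \<open>k j = 2 c\<^sub>1 + c\<^sub>2\<close> modulo \<open>4\<close> bounds \<open>j > 0\<close>, hence \<open>c\<^sub>0\<close>, from below, so that one of the Moves 2--5
  applies. Hence a
  priority reduction exists unless the array is \<open>T\<close>. Reductions are deterministic, preserve the
  value and decrease the sum of the entries, which gives (a); (b) is (a) read backwards.
\<close>

section \<open>Rows\<close>

text \<open>Four times the sum of the 1 / 2^a over the entries of the row, so the factor 4 clears
  all denominators; the power of \<open>k\<close> is left out.\<close>

fun weight :: "row \<Rightarrow> nat" where
  "weight (x, y, z) = 4 * x + 2 * y + z"

fun row_sum :: "row \<Rightarrow> nat" where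
  "row_sum (x, y, z) = x + y + z"

lemma weight_0 [simp]: "weight 0 = 0"
  by (simp add: zero_prod_def)

lemma row_sum_0 [simp]: "row_sum 0 = 0"
  by (simp add: zero_prod_def)

lemma weight_eq_0_iff: "weight r = 0 \<longleftrightarrow> r = 0"
  by (cases r) (auto simp: zero_prod_def)

lemma weight_add: "weight (r + s) = weight r + weight s"
  by (cases r; cases s) simp

lemma row_sum_add: "row_sum (r + s) = row_sum r + row_sum s"
  by (cases r; cases s) simp

lemma row_diff_add:
  fixes u r :: row
  assumes "u \<le> r"
  shows "r - u + u = r"
  using assms by (cases r; cases u) auto

lemma weight_diff: "u \<le> r \<Longrightarrow> weight (r - u) + weight u = weight r"
  by (metis weight_add row_diff_add)

lemma row_sum_diff: "u \<le> r \<Longrightarrow> row_sum (r - u) + row_sum u = row_sum r"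
  by (metis row_sum_add row_diff_add)

section \<open>Rules\<close>

text \<open>Treats Moves 2--5 uniformly. Undefined moves contribute \<open>None\<close>; statements
  about rules concern the members \<open>Some (u, v)\<close> only.\<close>

definition rules :: "nat \<Rightarrow> (row \<times> row) option set" where
  "rules k = {rule2 k, rule3 k, rule4 k, rule5 k}"

lemma mod_4_cases:
  fixes k :: nat
  obtains q where "k = 4 * q" | q where "k = 4 * q + 1"
    | q where "k = 4 * q + 2" | q where "k = 4 * q + 3"
proof -
  have "k mod 4 \<in> {0, 1, 2, 3}"
    by auto
  then show thesis
    using that[of "k div 4"] mult_div_mod_eq[of 4 k] by force
qed

text \<open>Writing \<open>k\<close> through \<open>q\<close> resolves the divisions in the rules,
  so that later facts become linear. Move 4 has one form for all odd \<open>k\<close>, hence its own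
  parametrisation \<open>k = 2 * q + 1\<close>.\<close>

lemma rules_cases:
  assumes "Some (u, v) \<in> rules k"
  obtains q where "k = 4 * q" "u = (q, 0, 0)" "v = (0, 0, 1)"
    | q where "k = 4 * q + 2" "u = (2 * q + 1, 0, 0)" "v = (0, 1, 0)"
    | q where "k = 4 * q + 2" "u = (q, 1, 0)" "v = (0, 0, 1)"
    | "odd k" "u = (k, 0, 0)" "v = (1, 0, 0)"
    | q where "k = 2 * q + 1" "u = (q, 1, 0)" "v = (0, 1, 0)"
    | q where "k = 4 * q + 1" "u = (q, 0, 1)" "v = (0, 0, 1)"
    | q where "k = 4 * q + 1" "u = (3 * q, 1, 1)" "v = (0, 1, 1)"
    | q where "k = 4 * q + 3" "u = (3 * q + 2, 0, 1)" "v = (0, 1, 1)"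
    | q where "k = 4 * q + 3" "u = (q, 1, 1)" "v = (0, 0, 1)"
proof (cases k rule: mod_4_cases)
  case (1 q)
  then show thesis
    using that(1) assms by (auto simp: rules_def rule2_def rule3_def rule4_def rule5_def)
next
  case (2 q)
  have "k mod 4 = 1" "odd k" "(k - 1) div 4 = q" "(k - 1) div 2 = 2 * q" "(3 * k - 3) div 4 = 3 * q"
    using 2 by presburger+
  then show thesis
    using that(4,6,7) that(5)[of "2 * q"] 2 assms
    by (auto simp: rules_def rule2_def rule3_def rule4_def rule5_def)
next
  case (3 q)
  have "k mod 4 = 2" "even k" "k div 2 = 2 * q + 1" "(k - 2) div 4 = q"
    using 3 by presburger+
  then show thesis
    using that(2,3) 3 assms by (auto simp: rules_def rule2_def rule3_def rule4_def rule5_def)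
next
  case (4 q)
  have "k mod 4 = 3" "odd k" "(3 * k - 1) div 4 = 3 * q + 2" "(k - 1) div 2 = 2 * q + 1"
    "(k - 3) div 4 = q"
    using 4 by presburger+
  then show thesis
    using that(4,8,9) that(5)[of "2 * q + 1"] 4 assms
    by (auto simp: rules_def rule2_def rule3_def rule4_def rule5_def)
qed

text \<open>An entry in row b + 1 is worth 1/k of the same entry in row b, so this says that Moves
  2--5 preserve the value.\<close>

lemma rules_weight: "Some (u, v) \<in> rules k \<Longrightarrow> weight u = k * weight v"
  by (erule rules_cases) auto

text \<open>The exclusions are essential: for \<open>k = 4\<close>, Move 2 trades a single entry for
  a single entry.\<close>

lemma rules_row_sum:
  assumes "Some (u, v) \<in> rules k" "k \<ge> 3" "k \<noteq> 4"
  shows "row_sum v < row_sum u"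
  using assms(1) by (rule rules_cases) (use assms(2,3) in auto)

text \<open>With \<open>s = j mod 4\<close>, the residue of \<open>k * s\<close> modulo 4 equals
  \<open>2 * y + z\<close> and thus fixes \<open>y\<close> and \<open>z\<close>. Since
  \<open>j\<close> is at least \<open>s\<close>, and at least 4 if \<open>s = 0\<close>, the
  equation bounds \<open>x\<close> from below by the first entry of a rule with these
  \<open>y\<close> and \<open>z\<close>, or with 0 in their place.\<close>

lemma rule_applicable:
  assumes "k \<ge> 3" "k dvd weight (x, y, z)" "weight (x, y, z) > 0" "y < 2" "z < 2"
  shows "\<exists>u v. Some (u, v) \<in> rules k \<and> u \<le> (x, y, z)"
proof -
  obtain j where j: "4 * x + 2 * y + z = k * j"
    using assms(2) by auto
  then have "j > 0"
    using assms(3) by (cases j) auto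
  define i where "i = j div 4"
  define s where "s = j mod 4"
  \<comment> \<open>Naming the product of the two unknowns keeps the later equations linear once
    \<open>s\<close> is one of 0, 1, 2, 3.\<close>
  define p where "p = k div 4 * i"
  have "j = 4 * i + s"
    by (simp add: i_def s_def)
  then have i: "s = 0 \<longrightarrow> i \<ge> 1" and p: "s = 0 \<longrightarrow> k div 4 \<le> p"
    using \<open>j > 0\<close> by (auto simp: p_def)
  have "s < 4"
    by (simp add: s_def)
  then have s: "s \<in> {0, 1, 2, 3}"
    by auto
  have applicable: ?thesis if "Some (u, v) \<in> rules k" "u \<le> (x, y, z)" for u v
    using that by blast
  have yz: "y \<in> {0, 1}" "z \<in> {0, 1}"
    using assms(4,5) by auto
  show ?thesis
  proof (cases k rule: mod_4_cases)
    case (1 q)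
    then have "4 * x + 2 * y + z = 16 * p + 4 * (q * s)"
      using j \<open>j = 4 * i + s\<close> by (simp add: p_def algebra_simps)
    then have "y = 0 \<and> z = 0 \<and> q \<le> x"
      using s yz p 1 by auto presburger+
    moreover have "Some ((q, 0, 0), (0, 0, 1)) \<in> rules k"
      using 1 by (simp add: rules_def rule2_def)
    ultimately show ?thesis
      using applicable by simp
  next
    case (2 q)
    have mod: "k mod 4 = 1" "odd k"
      using 2 by presburger+
    have div: "(k - 1) div 4 = q" "(k - 1) div 2 = 2 * q" "(3 * k - 3) div 4 = 3 * q"
      using 2 by presburger+
    have q: "k div 4 = q"
      using 2 by simp
    have eq: "4 * x + 2 * y + z = 4 * (4 * p + q * s + i) + s"
      using j \<open>j = 4 * i + s\<close> unfolding p_def q by (simp add: 2 algebra_simps)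
    then have "(2 * y + z) mod 4 = s mod 4"
      by (metis add.assoc mod_mult_self4)
    then consider "y = 0" "z = 0" "s = 0"
      | "y = 0" "z = 1" "s = 1"
      | "y = 1" "z = 0" "s = 2"
      | "y = 1" "z = 1" "s = 3"
      using s yz by auto
    \<comment> \<open>Here \<open>2 * y + z = s\<close>, so \<open>x = 4 * p + q * s + i\<close>.
      For \<open>s = 0\<close> the bounds \<open>p >= q\<close> and \<open>i >= 1\<close> give
      \<open>x >= k\<close>.\<close>
    then consider "y = 0" "z = 0" "k \<le> x"
      | "y = 0" "z = 1" "q \<le> x"
      | "y = 1" "z = 0" "2 * q \<le> x"
      | "y = 1" "z = 1" "3 * q \<le> x"
      using eq p i 2 q by cases auto
    then show ?thesis
    proof cases
      case 1
      have "Some ((k, 0, 0), (1, 0, 0)) \<in> rules k"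
        using mod div by (simp add: rules_def rule2_def rule3_def rule4_def rule5_def)
      then show ?thesis
        by (rule applicable) (use 1 in simp)
    next
      case 2
      have "Some ((q, 0, 1), (0, 0, 1)) \<in> rules k"
        using mod div by (simp add: rules_def rule2_def rule3_def rule4_def rule5_def)
      then show ?thesis
        by (rule applicable) (use 2 in simp)
    next
      case 3
      have "Some ((2 * q, 1, 0), (0, 1, 0)) \<in> rules k"
        using mod div by (simp add: rules_def rule2_def rule3_def rule4_def rule5_def)
      then show ?thesis
        by (rule applicable) (use 3 in simp)
    next
      case 4
      have "Some ((3 * q, 1, 1), (0, 1, 1)) \<in> rules k"
        using mod div by (simp add: rules_def rule2_def rule3_def rule4_def rule5_def)
      then show ?thesis
        by (rule applicable) (use 4 in simp)
    qed
  next
    case (3 q)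
    have mod: "k mod 4 = 2" "even k"
      using 3 by presburger+
    have div: "k div 2 = 2 * q + 1" "(k - 2) div 4 = q"
      using 3 by presburger+
    have q: "k div 4 = q"
      using 3 by simp
    have eq: "4 * x + 2 * y + z = 4 * (4 * p + q * s + 2 * i) + 2 * s"
      using j \<open>j = 4 * i + s\<close> unfolding p_def q by (simp add: 3 algebra_simps)
    then have "(2 * y + z) mod 4 = (2 * s) mod 4"
      by (metis add.assoc mod_mult_self4)
    \<comment> \<open>Only the parity of \<open>s\<close> is visible modulo 4, so four residues lead
      to just two rules.\<close>
    then consider "y = 0" "z = 0" "s = 0"
      | "y = 0" "z = 0" "s = 2"
      | "y = 1" "z = 0" "s = 1"
      | "y = 1" "z = 0" "s = 3"
      using s yz by auto
    then consider "y = 0" "z = 0" "2 * q + 1 \<le> x"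
      | "y = 1" "z = 0" "q \<le> x"
      using eq p i 3 q by cases auto
    then show ?thesis
    proof cases
      case 1
      have "Some ((2 * q + 1, 0, 0), (0, 1, 0)) \<in> rules k"
        using mod div by (simp add: rules_def rule2_def rule3_def rule4_def rule5_def)
      then show ?thesis
        by (rule applicable) (use 1 in simp)
    next
      case 2
      have "Some ((q, 1, 0), (0, 0, 1)) \<in> rules k"
        using mod div by (simp add: rules_def rule2_def rule3_def rule4_def rule5_def)
      then show ?thesis
        by (rule applicable) (use 2 in simp)
    qed
  next
    case (4 q)
    have mod: "k mod 4 = 3" "odd k"
      using 4 by presburger+
    have div: "(3 * k - 1) div 4 = 3 * q + 2" "(k - 1) div 2 = 2 * q + 1" "(k - 3) div 4 = q"
      using 4 by presburger+
    have q: "k div 4 = q"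
      using 4 by simp
    have eq: "4 * x + 2 * y + z = 4 * (4 * p + q * s + 3 * i) + 3 * s"
      using j \<open>j = 4 * i + s\<close> unfolding p_def q by (simp add: 4 algebra_simps)
    then have "(2 * y + z) mod 4 = (3 * s) mod 4"
      by (metis add.assoc mod_mult_self4)
    then consider "y = 0" "z = 0" "s = 0"
      | "y = 0" "z = 1" "s = 3"
      | "y = 1" "z = 0" "s = 2"
      | "y = 1" "z = 1" "s = 1"
      using s yz by auto
    \<comment> \<open>The constants 2 and 1 are the carries: \<open>3 * s\<close> is 9 = 4 * 2 + 1
      for \<open>s = 3\<close> and 6 = 4 * 1 + 2 for \<open>s = 2\<close>.\<close>
    then consider "y = 0" "z = 0" "k \<le> x"
      | "y = 0" "z = 1" "3 * q + 2 \<le> x"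
      | "y = 1" "z = 0" "2 * q + 1 \<le> x"
      | "y = 1" "z = 1" "q \<le> x"
      using eq p i 4 q by cases auto
    then show ?thesis
    proof cases
      case 1
      have "Some ((k, 0, 0), (1, 0, 0)) \<in> rules k"
        using mod div by (simp add: rules_def rule2_def rule3_def rule4_def rule5_def)
      then show ?thesis
        by (rule applicable) (use 1 in simp)
    next
      case 2
      have "Some ((3 * q + 2, 0, 1), (0, 1, 1)) \<in> rules k"
        using mod div by (simp add: rules_def rule2_def rule3_def rule4_def rule5_def)
      then show ?thesis
        by (rule applicable) (use 2 in simp)
    next
      case 3
      have "Some ((2 * q + 1, 1, 0), (0, 1, 0)) \<in> rules k"
        using mod div by (simp add: rules_def rule2_def rule3_def rule4_def rule5_def)
      then show ?thesis
        by (rule applicable) (use 3 in simp)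
    next
      case 4
      have "Some ((q, 1, 1), (0, 0, 1)) \<in> rules k"
        using mod div by (simp add: rules_def rule2_def rule3_def rule4_def rule5_def)
      then show ?thesis
        by (rule applicable) (use 4 in simp)
    qed
  qed
qed

section \<open>Values of arrays\<close>

text \<open>The value carries a factor \<open>4\<close>, since \<open>weight\<close> does.\<close>

definition has_value_1 :: "nat \<Rightarrow> nat \<Rightarrow> array \<Rightarrow> bool" where
  "has_value_1 k N A \<longleftrightarrow>
     (\<forall>b>N. A b = 0) \<and> (\<Sum>b\<le>N. real (weight (A b)) / real k ^ b) = 4"

text \<open>The termination measure. The bound \<open>N\<close> stays fixed along a sequence of
  reductions, even when the top row drops.\<close>

definition entry_sum :: "nat \<Rightarrow> array \<Rightarrow> nat" where
  "entry_sum N A = (\<Sum>b\<le>N. row_sum (A b))"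

text \<open>Stated without subtraction, so that it serves both the real values and the natural entry
  sums.\<close>

lemma sum_fun_upd:
  fixes h :: "'i \<Rightarrow> 'r \<Rightarrow> 'c::comm_monoid_add"
  assumes "finite I" "i \<in> I"
  shows "(\<Sum>j\<in>I. h j ((A(i := r)) j)) + h i (A i) = (\<Sum>j\<in>I. h j (A j)) + h i r"
proof -
  have "(\<Sum>j\<in>I. h j ((A(i := r)) j)) = h i r + (\<Sum>j\<in>I - {i}. h j (A j))"
    using assms by (subst sum.remove[of I i]) (auto intro!: sum.cong)
  moreover have "(\<Sum>j\<in>I. h j (A j)) = h i (A i) + (\<Sum>j\<in>I - {i}. h j (A j))"
    using assms by (subst sum.remove[of I i]) auto
  ultimately show ?thesis
    by (simp add: ac_simps)
qed

text \<open>A nonzero value forces a nonzero row, and \<open>N\<close> bounds the support, so the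
  \<open>Max\<close> in \<open>top_row\<close> is taken over a finite nonempty set.\<close>

lemma has_value_1_top_row:
  assumes "has_value_1 k N A"
  shows "A (top_row A) \<noteq> 0" "b > top_row A \<Longrightarrow> A b = 0" "top_row A \<le> N"
proof -
  have sub: "{b. A b \<noteq> 0} \<subseteq> {..N}"
    using assms by (auto simp: has_value_1_def) (meson not_le)
  then have fin: "finite {b. A b \<noteq> 0}"
    by (rule finite_subset) simp
  have ne: "{b. A b \<noteq> 0} \<noteq> {}"
  proof
    assume "{b. A b \<noteq> 0} = {}"
    then have "A b = 0" for b
      by blast
    then show False
      using assms by (simp add: has_value_1_def)
  qed
  show top: "A (top_row A) \<noteq> 0"
    using Max_in[OF fin ne] by (simp add: top_row_def)
  then show "top_row A \<le> N"
    using sub by auto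
  show "A b = 0" if "b > top_row A"
    using Max_ge[OF fin, of b] that by (auto simp: top_row_def)
qed

lemma has_value_1_cut:
  assumes "has_value_1 k N A" "M \<le> N" "\<And>b. b > M \<Longrightarrow> A b = 0"
  shows "has_value_1 k M A"
proof -
  have "(\<Sum>b\<le>M. real (weight (A b)) / real k ^ b) = (\<Sum>b\<le>N. real (weight (A b)) / real k ^ b)"
    using assms(2,3) by (intro sum.mono_neutral_left) auto
  then show ?thesis
    using assms by (simp add: has_value_1_def)
qed

text \<open>After multiplication by \<open>k ^ Suc b\<close>, the right-hand side and every term
  below row \<open>Suc b\<close> are multiples of \<open>k\<close>, which leaves the term of that
  row.\<close>

lemma has_value_1_dvd:
  assumes "has_value_1 k (Suc b) A" "k > 0"
  shows "k dvd weight (A (Suc b))"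
proof -
  let ?s = "\<Sum>j\<le>b. weight (A j) * k ^ (b - j)"
  have "real k ^ Suc b * (\<Sum>j\<le>Suc b. real (weight (A j)) / real k ^ j) =
      real k * (\<Sum>j\<le>b. real k ^ b * (real (weight (A j)) / real k ^ j)) + weight (A (Suc b))"
    using assms(2) by (simp add: field_simps sum_distrib_left)
  also have "(\<Sum>j\<le>b. real k ^ b * (real (weight (A j)) / real k ^ j)) = real ?s"
  proof -
    have "real k ^ b = real k ^ j * real k ^ (b - j)" if "j \<le> b" for j
      using that by (simp flip: power_add)
    then show ?thesis
      using assms(2) by (simp add: field_simps)
  qed
  finally have "real (4 * k ^ Suc b) = real (k * ?s + weight (A (Suc b)))"
    using assms(1) by (simp add: has_value_1_def)
  then have "4 * k ^ Suc b = k * ?s + weight (A (Suc b))"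
    by (simp only: of_nat_eq_iff)
  moreover have "k dvd 4 * k ^ Suc b" "k dvd k * ?s"
    by simp_all
  ultimately show ?thesis
    by (metis dvd_add_right_iff)
qed

section \<open>Invariance of the value and decrease of the entry sum under reductions\<close>

lemma reduce_in_row_has_value_1:
  assumes "has_value_1 k N A" "b \<le> N" "reduce_in_row u v b A = Some B"
    and "weight u = weight v" "row_sum v < row_sum u"
  shows "has_value_1 k N B" "entry_sum N B < entry_sum N A"
proof -
  have le: "u \<le> A b" and B: "B = A(b := A b - u + v)"
    using assms(3) by (auto simp: reduce_in_row_def split: if_splits)
  have "weight (A b - u + v) = weight (A b)"
    using weight_diff[OF le] assms(4) by (simp add: weight_add)
  then have "(\<Sum>j\<le>N. real (weight (B j)) / real k ^ j) = (\<Sum>j\<le>N. real (weight (A j)) / real k ^ j)"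
    by (intro sum.cong) (auto simp: B)
  then show "has_value_1 k N B"
    using assms(1,2) by (simp add: has_value_1_def B)
  have "row_sum (A b - u + v) < row_sum (A b)"
    using row_sum_diff[OF le] assms(5) by (simp add: row_sum_add)
  then show "entry_sum N B < entry_sum N A"
    using sum_fun_upd[of "{..N}" b "\<lambda>_. row_sum" A "A b - u + v"] assms(2)
    by (simp add: entry_sum_def B)
qed

lemma reduce_rows_has_value_1:
  assumes "has_value_1 k N A" "Suc b \<le> N" "reduce_rows r b A = Some B"
    and "r \<in> rules k" "k \<ge> 3" "k \<noteq> 4"
  shows "has_value_1 k N B" "entry_sum N B < entry_sum N A"
proof -
  obtain u v where r: "r = Some (u, v)" and le: "u \<le> A (Suc b)"
    and B: "B = A(Suc b := A (Suc b) - u, b := A b + v)"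
    using assms(3) by (auto simp: reduce_rows_def split: option.splits if_splits)
  \<comment> \<open>The array between the two row updates, so that \<open>sum_fun_upd\<close>
    applies to each in turn.\<close>
  let ?C = "A(Suc b := A (Suc b) - u)"
  have uv: "weight u = k * weight v" "row_sum v < row_sum u"
    using assms(4-6) rules_weight rules_row_sum by (auto simp: r)
  let ?h = "\<lambda>j s. real (weight s) / real k ^ j"
  have "weight (A (Suc b) - u) + k * weight v = weight (A (Suc b))"
    using weight_diff[OF le] uv(1) by simp
  then have "?h (Suc b) (A (Suc b)) = ?h (Suc b) (A (Suc b) - u) + ?h b v"
    using assms(5) by (simp add: field_simps flip: of_nat_mult of_nat_add)
  moreover have "?h b (A b + v) = ?h b (A b) + ?h b v"
    by (simp add: weight_add add_divide_distrib)
  ultimately have "(\<Sum>j\<le>N. ?h j (B j)) = (\<Sum>j\<le>N. ?h j (A j))"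
    using sum_fun_upd[of "{..N}" "Suc b" ?h A "A (Suc b) - u"]
      sum_fun_upd[of "{..N}" b ?h ?C "A b + v"] assms(2)
    by (simp add: B)
  then show "has_value_1 k N B"
    using assms(1,2) by (simp add: has_value_1_def B)
  show "entry_sum N B < entry_sum N A"
    using sum_fun_upd[of "{..N}" "Suc b" "\<lambda>_. row_sum" A "A (Suc b) - u"]
      sum_fun_upd[of "{..N}" b "\<lambda>_. row_sum" ?C "A b + v"] assms(2) uv(2) row_sum_diff[OF le]
    by (simp add: entry_sum_def B row_sum_add)
qed

lemma priority_list_has_value_1:
  assumes "has_value_1 k N A" "m \<in> set (priority_list (top_row A))" "reduce k m A = Some B"
    and "k \<ge> 3" "k \<noteq> 4"
  shows "has_value_1 k N B \<and> entry_sum N B < entry_sum N A"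
proof -
  note top = has_value_1_top_row(3)[OF assms(1)]
  consider "m = Move1 1 (top_row A)" | "m = Move1 0 (top_row A)"
    | b where "Suc b = top_row A" "m \<in> {Move2 b, Move3 b, Move4 b, Move5 b}"
    using assms(2) by (auto simp: priority_list_def split: nat.splits)
  then show ?thesis
  proof cases
    case 1
    then show ?thesis
      using reduce_in_row_has_value_1[OF assms(1) top] assms(3) by auto
  next
    case 2
    then show ?thesis
      using reduce_in_row_has_value_1[OF assms(1) top] assms(3) by auto
  next
    case 3
    have "\<exists>r\<in>rules k. reduce k m A = reduce_rows r b A"
      using 3(2) by (auto simp: rules_def)
    then obtain r where r: "r \<in> rules k" "reduce_rows r b A = Some B"
      using assms(3) by auto
    have "Suc b \<le> N"
      using 3(1) top by simp
    from reduce_rows_has_value_1[OF assms(1) this r(2,1) assms(4,5)] show ?thesis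
      by blast
  qed
qed

section \<open>Existence of a priority reduction\<close>

lemma priority_list_progress:
  assumes "has_value_1 k N A" "A \<noteq> T" "k \<ge> 3"
  shows "\<exists>m\<in>set (priority_list (top_row A)). \<exists>B. reduce k m A = Some B"
proof (rule ccontr)
  assume none: "\<not> ?thesis"
  note top = has_value_1_top_row[OF assms(1)]
  have cut: "has_value_1 k (top_row A) A"
    using has_value_1_cut[OF assms(1) top(3)] top(2) by blast
  obtain x y z where row: "A (top_row A) = (x, y, z)"
    by (cases "A (top_row A)") auto
  have y: "y < 2" and z: "z < 2"
    using none by (auto simp: priority_list_def reduce_in_row_def row not_le split: if_splits)
  show False
  proof (cases "top_row A")
    case 0
    then have "4 * x + 2 * y + z = 4"
      using cut row by (simp add: has_value_1_def)
    \<comment> \<open>\<open>2 * y + z\<close> is at most 3 and divisible by 4, hence 0.\<close>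
    then have "(x, y, z) = (1, 0, 0)"
      using y z by (simp, presburger)
    then have "A = T"
      using top(2) row 0 by (auto simp: T_def fun_eq_iff)
    then show False
      using assms(2) by simp
  next
    case (Suc b)
    have "k dvd weight (x, y, z)"
      using has_value_1_dvd[of k b A] cut Suc row assms(3) by simp
    moreover have "weight (x, y, z) > 0"
      using top(1) row weight_eq_0_iff by (metis neq0_conv)
    ultimately obtain u v where uv: "Some (u, v) \<in> rules k" "u \<le> (x, y, z)"
      using rule_applicable[of k x y z] assms(3) y z by blast
    then have "reduce_rows (Some (u, v)) b A \<noteq> None"
      using row Suc by (simp add: reduce_rows_def)
    then show False
      using none uv(1) Suc by (auto simp: priority_list_def rules_def)
  qed
qed

section \<open>Solutions and arrays\<close>

text \<open>\<open>k\<close> divides \<open>k ^ d\<close>, and divisors of a power of the prime 2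
  are powers of 2.\<close>

lemma power_of_2_if_power:
  fixes k :: nat
  assumes "k ^ d = 2 ^ e" "d > 0"
  shows "\<exists>m. k = 2 ^ m"
proof -
  have "k dvd 2 ^ e"
    using assms by (metis dvd_power)
  then show ?thesis
    using divides_primepow_nat[of 2 k e] by auto
qed

fun entry :: "row \<Rightarrow> nat \<Rightarrow> nat" where
  "entry (x, y, z) a = (if a = 0 then x else if a = 1 then y else z)"

text \<open>Serves to build a solution from an array; injectivity makes the prescribed
  multiplicities independent of each other.\<close>

lemma sorted_list_with_counts:
  fixes g :: "'i \<Rightarrow> 'a::linorder"
  assumes "finite I" "inj_on g I"
  shows "\<exists>xs. sorted xs \<and> set xs \<subseteq> g ` I \<and> (\<forall>i\<in>I. count_list xs (g i) = f i)"
  using assms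
proof (induction I rule: finite_induct)
  case (insert i J)
  then obtain xs where xs: "set xs \<subseteq> g ` J" "\<forall>j\<in>J. count_list xs (g j) = f j"
    by auto
  let ?ys = "sort (replicate (f i) (g i) @ xs)"
  have count: "count_list ?ys x = count_list (replicate (f i) (g i)) x + count_list xs x" for x
    by (metis count_list_append count_mset mset_sort)
  have "g i \<notin> g ` J"
    using insert.hyps(2) insert.prems by auto
  then have "count_list xs (g i) = 0"
    using xs(1) by (auto simp: count_list_0_iff)
  moreover have "g j \<noteq> g i" if "j \<in> J" for j
    using that \<open>g i \<notin> g ` J\<close> by (metis imageI)
  moreover have "count_list (replicate n y) x = (if x = y then n else 0)" for n and x y :: 'a
    by (induction n) auto
  ultimately have "\<forall>j\<in>insert i J. count_list ?ys (g j) = f j"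
    using xs(2) by (auto simp: count)
  moreover have "set ?ys \<subseteq> g ` insert i J"
    using xs(1) by auto
  ultimately show ?case
    by (intro exI[of _ ?ys]) auto
qed simp

lemma sum_list_eq_sum_count_list:
  fixes f :: "'a \<Rightarrow> 'b::comm_semiring_1"
  assumes "finite X" "set xs \<subseteq> X"
  shows "(\<Sum>x\<leftarrow>xs. f x) = (\<Sum>x\<in>X. of_nat (count_list xs x) * f x)"
  using assms(2)
proof (induction xs)
  case (Cons y xs)
  have "(\<Sum>x\<in>X. of_nat (count_list (y # xs) x) * f x) =
      (\<Sum>x\<in>X. (if y = x then f x else 0) + of_nat (count_list xs x) * f x)"
    by (intro sum.cong) (auto simp: algebra_simps)
  also have "\<dots> = f y + (\<Sum>x\<in>X. of_nat (count_list xs x) * f x)"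
    using Cons.prems assms(1) by (simp add: sum.distrib)
  finally show ?case
    using Cons by simp
qed simp

section \<open>Unique representation of the elements of S(k), and the arrays of solutions\<close>

locale not_power_of_2 =
  fixes k :: nat
  assumes pos: "k > 0" and not_power: "\<nexists>m. k = 2 ^ m"
begin

lemma ge_3: "k \<ge> 3" and neq_4: "k \<noteq> 4"
proof -
  have "k \<noteq> 2 ^ 0" "k \<noteq> 2 ^ 1" "k \<noteq> 2 ^ 2"
    using not_power by blast+
  then show "k \<ge> 3" "k \<noteq> 4"
    using pos by auto
qed

definition denom :: "nat \<times> nat \<Rightarrow> nat" where
  "denom = (\<lambda>(a, b). 2 ^ a * k ^ b)"

text \<open>If the exponents of \<open>k\<close> differed, cancelling the smaller power would make a
  positive power of \<open>k\<close> divide a power of 2, and \<open>k\<close> would be a power of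
  2.\<close>

lemma inj_denom: "inj denom"
proof -
  have le: "b' \<le> b" if "(2::nat) ^ a * k ^ b = 2 ^ a' * k ^ b'" for a b a' b'
  proof (rule ccontr)
    assume "\<not> b' \<le> b"
    then have "b' = b + (b' - b)" and d: "b' - b > 0"
      by auto
    then have "k ^ b' = k ^ b * k ^ (b' - b)"
      by (metis power_add)
    then have eq: "(2::nat) ^ a = 2 ^ a' * k ^ (b' - b)"
      using that pos by simp
    then have "k ^ (b' - b) dvd 2 ^ a"
      by simp
    then have "\<exists>e. k ^ (b' - b) = 2 ^ e"
      using divides_primepow_nat[of 2] by auto
    then show False
      using power_of_2_if_power[OF _ d] not_power by blast
  qed
  show ?thesis
  proof (rule injI)
    fix p q assume "denom p = denom q"
    then have eq: "2 ^ fst p * k ^ snd p = 2 ^ fst q * k ^ snd q"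
      by (simp add: denom_def split_beta)
    then have "snd p = snd q"
      using le[OF eq] le[OF eq[symmetric]] by simp
    then show "p = q"
      using eq pos by (simp add: prod_eq_iff)
  qed
qed

lemma S_eq: "S k = denom ` ({..2} \<times> UNIV)"
proof -
  have "{0, 1, 2} = {..2::nat}"
    by auto
  then show ?thesis
    by (auto simp: S_def denom_def)
qed

lemma sum_inverse_eq:
  assumes "set xs \<subseteq> denom ` ({..2} \<times> {..N})"
  shows "(\<Sum>b\<le>N. real (weight (array_of k xs b)) / real k ^ b) = 4 * (\<Sum>x\<leftarrow>xs. 1 / real x)"
proof -
  have inj: "inj_on denom X" for X
    using inj_denom by (rule inj_on_subset) simp
  have "(\<Sum>x\<leftarrow>xs. 1 / real x) =
      (\<Sum>x\<in>denom ` ({..2} \<times> {..N}). count_list xs x * (1 / real x))"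
    using assms by (intro sum_list_eq_sum_count_list) auto
  also have "\<dots> = (\<Sum>p\<in>{..2} \<times> {..N}. count_list xs (denom p) * (1 / real (denom p)))"
    by (simp add: sum.reindex[OF inj])
  also have "\<dots> = (\<Sum>b\<le>N. \<Sum>a\<le>2. count_list xs (denom (a, b)) * (1 / real (denom (a, b))))"
    by (subst sum.swap) (simp add: sum.cartesian_product)
  also have "4 * \<dots> = (\<Sum>b\<le>N. real (weight (array_of k xs b)) / real k ^ b)"
    unfolding sum_distrib_left[of 4 _ "{..N}"]
  proof (rule sum.cong[OF refl])
    fix b
    have "(\<Sum>a\<le>2. f a) = f 0 + f 1 + f 2" for f :: "nat \<Rightarrow> real"
      by (simp add: numeral_2_eq_2)
    then show "4 * (\<Sum>a\<le>2. count_list xs (denom (a, b)) * (1 / real (denom (a, b)))) =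
        real (weight (array_of k xs b)) / real k ^ b"
      using pos by (simp add: array_of_def denom_def add_divide_distrib distrib_left)
  qed
  finally show ?thesis ..
qed

text \<open>Replaces lists by a single equation. The direction from right to left shows that the
  arrays reached by reductions come from solutions again, as \<open>priority_reduction\<close>
  demands.\<close>

lemma solution_array_iff: "solution_array k A \<longleftrightarrow> (\<exists>N. has_value_1 k N A)"
proof
  assume "solution_array k A"
  then obtain xs where xs: "set xs \<subseteq> S k" "(\<Sum>x\<leftarrow>xs. 1 / real x) = 1" and A: "A = array_of k xs"
    by (auto simp: solution_array_def is_solution_def)
  obtain P where P: "P \<subseteq> {..2} \<times> UNIV" "finite P" "set xs = denom ` P"
    using finite_subset_image[OF _ xs(1)[unfolded S_eq]] by auto
  \<comment> \<open>The inserted 0 keeps the set nonempty, so that \<open>Max\<close> is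
    meaningful.\<close>
  define N where "N = Max (insert 0 (snd ` P))"
  have N: "snd p \<le> N" if "p \<in> P" for p
    using that P(2) by (simp add: N_def)
  have "P \<subseteq> {..2} \<times> {..N}"
    using P(1) N by fastforce
  then have "set xs \<subseteq> denom ` ({..2} \<times> {..N})"
    using P(3) by auto
  moreover have "A b = 0" if "b > N" for b
  proof -
    have "denom (a, b) \<notin> set xs" for a
      using N[of "(a, b)"] that inj_denom by (auto simp: P(3) dest: injD)
    then have "count_list xs (2 ^ a * k ^ b) = 0" for a
      by (simp add: denom_def count_notin)
    then show ?thesis
      unfolding A array_of_def by (simp only: zero_prod_def)
  qed
  ultimately show "\<exists>N. has_value_1 k N A"
    using sum_inverse_eq[of xs N] xs(2) by (auto simp: has_value_1_def A)
next
  assume "\<exists>N. has_value_1 k N A"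
  then obtain N where N: "has_value_1 k N A" ..
  let ?I = "{..2} \<times> {..N}"
  have "inj_on denom ?I"
    using inj_denom by (rule inj_on_subset) simp
  then obtain xs where xs: "sorted xs" "set xs \<subseteq> denom ` ?I"
    and count: "\<forall>p\<in>?I. count_list xs (denom p) = entry (A (snd p)) (fst p)"
    using sorted_list_with_counts[of ?I denom "\<lambda>p. entry (A (snd p)) (fst p)"] by auto
  have "array_of k xs b = A b" for b
  proof (cases "b \<le> N")
    case True
    then have "count_list xs (2 ^ a * k ^ b) = entry (A b) a" if "a \<le> 2" for a
      using count that by (force simp: denom_def)
    from this[of 0] this[of 1] this[of 2] show ?thesis
      by (cases "A b") (simp add: array_of_def)
  next
    case False
    then have "denom (a, b) \<notin> set xs" for a
      using xs(2) inj_denom by (auto dest!: injD subsetD)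
    then have "count_list xs (2 ^ a * k ^ b) = 0" for a
      by (simp add: denom_def count_notin)
    then show ?thesis
      using N False unfolding array_of_def has_value_1_def by (simp only: not_le zero_prod_def)
  qed
  then have A: "A = array_of k xs"
    by auto
  have sum: "(\<Sum>x\<leftarrow>xs. 1 / real x) = 1"
    using sum_inverse_eq[OF xs(2)] N by (simp add: has_value_1_def A)
  moreover have "set xs \<subseteq> S k"
    using xs(2) by (auto simp: S_eq)
  \<comment> \<open>The list is nonempty because its sum is 1.\<close>
  ultimately have "is_solution k xs"
    using xs(1) by (auto simp: is_solution_def)
  then show "solution_array k A"
    using A by (auto simp: solution_array_def)
qed

section \<open>Sequences of priority moves\<close>

lemma priority_move_eq_SomeD:
  assumes "priority_move k A = Some m"
  shows "m \<in> set (priority_list (top_row A))" "\<exists>B. reduce k m A = Some B"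
  using assms by (auto simp: priority_move_def reduction_def find_Some_iff)

text \<open>\<open>T\<close> is terminal: its top row is row 0, where only Move 1 could act, and it
  has no two entries to merge.\<close>

lemma priority_move_T: "priority_move k T = None"
proof -
  have "{b. T b \<noteq> 0} = {0}"
    by (auto simp: T_def zero_prod_def)
  then have "top_row T = 0"
    by (simp add: top_row_def)
  then show ?thesis
    by (simp add: priority_move_def priority_list_def reduction_def reduce_in_row_def T_def)
qed

text \<open>Induction on the entry sum. Both the priority move and its result are functions of the
  array, so every sequence from an array other than \<open>T\<close> starts with the same
  step.\<close>

lemma ex1_priority_reductions:
  assumes "has_value_1 k N A"
  shows "\<exists>!ms. move_sequence (priority_reduction k) A ms T"
  using assms
proof (induction "entry_sum N A" arbitrary: A rule: less_induct)
  case less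
  show ?case
  proof (cases "A = T")
    case True
    have "ms = []" if "move_sequence (priority_reduction k) T ms T" for ms
      using that by (cases ms) (auto simp: priority_reduction_def priority_move_T)
    then show ?thesis
      using True by (intro ex1I[of _ "[]"]) auto
  next
    case False
    have "\<exists>m. priority_move k A = Some m"
      using priority_list_progress[OF less.prems False ge_3]
      by (auto simp: priority_move_def reduction_def find_None_iff simp flip: not_None_eq)
    then obtain m where m: "priority_move k A = Some m" ..
    then obtain B where B: "reduce k m A = Some B"
      using priority_move_eq_SomeD(2) by blast
    have "has_value_1 k N B" "entry_sum N B < entry_sum N A"
      using priority_list_has_value_1[OF less.prems priority_move_eq_SomeD(1)[OF m] B ge_3 neq_4]
      by auto
    then obtain ms where ms: "move_sequence (priority_reduction k) B ms T"
      and unique: "\<And>ms'. move_sequence (priority_reduction k) B ms' T \<Longrightarrow> ms' = ms"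
      using less.hyps by blast
    have step: "priority_reduction k m' A C \<longleftrightarrow> m' = m \<and> C = B" for m' C
      using m B less.prems solution_array_iff by (auto simp: priority_reduction_def reduction_def)
    show ?thesis
    proof (rule ex1I[of _ "m # ms"])
      show "move_sequence (priority_reduction k) A (m # ms) T"
        using ms by (auto simp: step)
      show "ms' = m # ms" if "move_sequence (priority_reduction k) A ms' T" for ms'
        using that False unique by (cases ms') (auto simp: step)
    qed
  qed
qed

end

section \<open>Reversal of move sequences\<close>

lemma move_sequence_append:
  "move_sequence R A (ms @ ns) B \<longleftrightarrow> (\<exists>C. move_sequence R A ms C \<and> move_sequence R C ns B)"
  by (induction ms arbitrary: A) auto

lemma move_sequence_rev:
  "move_sequence (\<lambda>m A B. R m B A) A ms B \<longleftrightarrow> move_sequence R B (rev ms) A"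
  by (induction ms arbitrary: A) (auto simp: move_sequence_append)

lemma move_sequence_priority_expansion:
  "move_sequence (priority_expansion k) A ms B \<longleftrightarrow>
     move_sequence (priority_reduction k) B (rev ms) A"
proof -
  \<comment> \<open>A priority reduction already contains the underlying reduction, so a priority
    expansion is exactly its converse.\<close>
  have "priority_expansion k = (\<lambda>m A B. priority_reduction k m B A)"
    by (auto simp: fun_eq_iff priority_expansion_def expansion_def priority_reduction_def)
  then show ?thesis
    by (simp only: move_sequence_rev[of "priority_reduction k"])
qed

theorem proposition4:
  fixes k :: nat and A :: array
  assumes "k > 0" and "\<nexists>m. k = 2 ^ m"
    and "solution_array k A"
  shows "(\<exists>!ms. move_sequence (priority_reduction k) A ms T) \<and>
         (\<exists>!ms. move_sequence (priority_expansion k) T ms A)"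
proof -
  interpret not_power_of_2 k
    using assms(1,2) by unfold_locales
  obtain N where "has_value_1 k N A"
    using assms(3) solution_array_iff by blast
  then have ex1: "\<exists>!ms. move_sequence (priority_reduction k) A ms T"
    by (rule ex1_priority_reductions)
  then have "\<exists>!ms. move_sequence (priority_expansion k) T ms A"
    \<comment> \<open>\<open>rev\<close> is an involution on lists, so existence and uniqueness
      carry over.\<close>
    unfolding move_sequence_priority_expansion by (metis rev_rev_ident)
  with ex1 show ?thesis ..
qed

end
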